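(* Let $\gamma:\Gamma\to\Delta$ be a forwards immersion of finite graphs, let $w:I\to\Delta$ be a primitive loop and let $\hat w:S^1\to\Delta$ be the associated primitive cycle. There are at most $2\cdot|\bar E(\Gamma)|$ components of $\Omega^3_{\gamma,w}$ that do not factor through $\Gamma-\bar V(\Gamma)$ (that is, whose image in $\Gamma$ under the projection contains a vertex of $\bar V(\Gamma)$).
   Context: A graph is a directed graph $\Gamma=(V,E,o,t)$ with origin and target maps $o,t:E\to V$ (loops and multiple edges allowed). A graph map commutes with $o,t$; it is a forwards immersion if, at every vertex $v$, it is injective on the set of edges with origin $v$. A path is a graph map from a directed segment $I$; it is identified with the word of edges it traverses; $*$ is concatenation. A path $w$ is a loop if its first and last vertices agree, and primitive if it is not $u^k$ for a path $u$ and $k\ge2$. For a loop $w:I\to\Delta$, $\hat w:S^1\to\Delta$ is the cycle obtained by identifying the endpoints of $I$. $\bar V(\Gamma)$ is the set of vertices whose indegree is $\ne1$ or whose outdegree is $\ne1$; $\Gamma-\bar V(\Gamma)$ is the maximal subgraph containing no vertex of $\bar V(\Gamma)$. $\bar E(\Gamma)$ is the collection (up to reparametrisation) of paths, injective on edges, whose image meets $\bar V(\Gamma)$ exactly in their first and last vertices, together with cycles, injective on edges, whose image is disjoint from $\bar V(\Gamma)$ (maximal unbranched segments and circle components of $\Gamma$). The fibre product $\Gamma\times_\Delta S^1$ of $\gamma$ and $\hat w$ has vertices the pairs $(u,v)\in V(\Gamma)\times V(S^1)$ with equal image in $\Delta$, edges the pairs of edges with equal image, coordinatewise $o,t$. $\Omega_{\gamma,w}\subset\Gamma\times_\Delta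 S^1$ is the union of the connected components that surject onto $S^1$. A path $f:I\to\Gamma$ is a $w$-path if $\gamma\circ f$ factors surjectively through $\hat w$; then uniquely $\gamma\circ f=w'*w^n*w''$ with $w'$ a proper suffix and $w''$ a proper prefix of $w$ (possibly empty), and $|f|_w=n$ is its $w$-length. $\Omega^k_{\gamma,w}\subset\Omega_{\gamma,w}$ is the union of the components which support a $w$-path of $w$-length at least $k$, i.e. contain a path whose projection to $\Gamma$ is a $w$-path of $w$-length at least $k$. *)

theory Defs
  imports "Graph_Theory.Digraph_Component" "HOL-Library.Sublist"
begin

text \<open>
  Graphs are (well-formed) digraphs from the AFP entry Graph Theory, with \<open>tail\<close> as origin map and
  \<open>head\<close> as target map; loops and parallel arcs are allowed. A path is an \<open>awalk\<close>: a word of arcs,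
  together with its first vertex, which matters only for the empty word.
\<close>

subsection \<open>Graph maps\<close>

record ('a, 'b, 'c, 'd) graph_map =
  vmap :: "'a \<Rightarrow> 'c"
  emap :: "'b \<Rightarrow> 'd"

definition is_graph_map ::
  "('a, 'b) pre_digraph \<Rightarrow> ('c, 'd) pre_digraph \<Rightarrow> ('a, 'b, 'c, 'd) graph_map \<Rightarrow> bool" where
  "is_graph_map A B f \<longleftrightarrow>
     vmap f ` verts A \<subseteq> verts B \<and> emap f ` arcs A \<subseteq> arcs B \<and>
     (\<forall>e\<in>arcs A. tail B (emap f e) = vmap f (tail A e) \<and> head B (emap f e) = vmap f (head A e))"

definition forwards_immersion ::
  "('a, 'b) pre_digraph \<Rightarrow> ('c, 'd) pre_digraph \<Rightarrow> ('a, 'b, 'c, 'd) graph_map \<Rightarrow> bool" where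
  "forwards_immersion A B f \<longleftrightarrow>
     is_graph_map A B f \<and> (\<forall>v\<in>verts A. inj_on (emap f) (out_arcs A v))"

definition map_surjects_onto ::
  "('a, 'b, 'c, 'd) graph_map \<Rightarrow> ('a, 'b) pre_digraph \<Rightarrow> ('c, 'd) pre_digraph \<Rightarrow> bool" where
  "map_surjects_onto f A B \<longleftrightarrow> vmap f ` verts A = verts B \<and> emap f ` arcs A = arcs B"

definition maps_into ::
  "('a, 'b, 'c, 'd) graph_map \<Rightarrow> ('a, 'b) pre_digraph \<Rightarrow> ('c, 'd) pre_digraph \<Rightarrow> bool" where
  "maps_into f A B \<longleftrightarrow> vmap f ` verts A \<subseteq> verts B \<and> emap f ` arcs A \<subseteq> arcs B"

text \<open>Components are taken in the undirected (weak) sense; \<open>connected\<close> excludes the null graph.\<close>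

definition components :: "('a, 'b) pre_digraph \<Rightarrow> ('a, 'b) pre_digraph set" where
  "components G = {C. pre_digraph.max_subgraph G connected C}"

subsection \<open>Unbranched segments\<close>

definition Vbar :: "('a, 'b) pre_digraph \<Rightarrow> 'a set" where
  "Vbar G = {v \<in> verts G. in_degree G v \<noteq> 1 \<or> out_degree G v \<noteq> 1}"

definition minus_Vbar :: "('a, 'b) pre_digraph \<Rightarrow> ('a, 'b) pre_digraph" where
  "minus_Vbar G = G \<restriction> (verts G - Vbar G)"

text \<open>
  A segment is nondegenerate, and it meets \<open>Vbar\<close> at its two end points and nowhere in between
  (it may not return to an end point halfway).
\<close>

definition unbranched_segment :: "('a, 'b) pre_digraph \<Rightarrow> 'b list \<Rightarrow> bool" where
  "unbranched_segment G p \<longleftrightarrow> p \<noteq> [] \<and>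
     (\<exists>u v. pre_digraph.trail G u p v \<and> u \<in> Vbar G \<and> v \<in> Vbar G \<and>
        set (butlast (tl (pre_digraph.awalk_verts G u p))) \<inter> Vbar G = {})"

definition unbranched_cycle :: "('a, 'b) pre_digraph \<Rightarrow> 'b list \<Rightarrow> bool" where
  "unbranched_cycle G p \<longleftrightarrow> p \<noteq> [] \<and>
     (\<exists>u. pre_digraph.trail G u p u \<and> set (pre_digraph.awalk_verts G u p) \<inter> Vbar G = {})"

text \<open>
  Each element is a class up to reparametrisation: a directed segment has no nontrivial
  reparametrisation, while those of a cycle are the rotations of its word.
\<close>

definition Ebar :: "('a, 'b) pre_digraph \<Rightarrow> 'b list set set" where
  "Ebar G = {{p} | p. unbranched_segment G p} \<union>
            {{rotate k p | k. True} | p. unbranched_cycle G p}"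

subsection \<open>Loops and their cycles\<close>

definition is_loop :: "('a, 'b) pre_digraph \<Rightarrow> 'b list \<Rightarrow> bool" where
  "is_loop G w \<longleftrightarrow> (\<exists>u. pre_digraph.awalk G u w u)"

text \<open>The empty path is a power of itself, hence not primitive.\<close>

definition primitive_path :: "('a, 'b) pre_digraph \<Rightarrow> 'b list \<Rightarrow> bool" where
  "primitive_path G w \<longleftrightarrow>
     \<not> (\<exists>x u y k. pre_digraph.awalk G x u y \<and> 2 \<le> k \<and> w = concat (replicate k u))"

definition circle :: "nat \<Rightarrow> (nat, nat) pre_digraph" where
  "circle n = \<lparr>verts = {..<n}, arcs = {..<n}, tail = (\<lambda>i. i), head = (\<lambda>i. Suc i mod n)\<rparr>"

text \<open>The cycle \<open>w\<close>-hat on \<open>circle (length w)\<close>, for a nonempty loop \<open>w\<close> in \<open>D\<close>.\<close>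

definition circle_map ::
  "('c, 'd) pre_digraph \<Rightarrow> 'd list \<Rightarrow> (nat, nat, 'c, 'd) graph_map" where
  "circle_map D w = \<lparr>vmap = (\<lambda>i. tail D (w ! i)), emap = (\<lambda>i. w ! i)\<rparr>"

subsection \<open>Fibre products\<close>

definition fibre_product ::
  "('a, 'b) pre_digraph \<Rightarrow> ('a, 'b, 'c, 'd) graph_map \<Rightarrow>
   ('e, 'f) pre_digraph \<Rightarrow> ('e, 'f, 'c, 'd) graph_map \<Rightarrow> ('a \<times> 'e, 'b \<times> 'f) pre_digraph" where
  "fibre_product A f B g =
     \<lparr>verts = {(u, v). u \<in> verts A \<and> v \<in> verts B \<and> vmap f u = vmap g v},
      arcs = {(d, e). d \<in> arcs A \<and> e \<in> arcs B \<and> emap f d = emap g e},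
      tail = map_prod (tail A) (tail B),
      head = map_prod (head A) (head B)\<rparr>"

definition proj1 :: "('a \<times> 'e, 'b \<times> 'f, 'a, 'b) graph_map" where
  "proj1 = \<lparr>vmap = fst, emap = fst\<rparr>"

definition proj2 :: "('a \<times> 'e, 'b \<times> 'f, 'e, 'f) graph_map" where
  "proj2 = \<lparr>vmap = snd, emap = snd\<rparr>"

definition Omega ::
  "('a, 'b) pre_digraph \<Rightarrow> ('c, 'd) pre_digraph \<Rightarrow> ('a, 'b, 'c, 'd) graph_map \<Rightarrow> 'd list \<Rightarrow>
   ('a \<times> nat, 'b \<times> nat) pre_digraph" where
  "Omega G D f w =
     (let P = fibre_product G f (circle (length w)) (circle_map D w)
      in pre_digraph.Union P {C \<in> components P. map_surjects_onto proj2 C (circle (length w))})"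

subsection \<open>Paths reading powers of a loop\<close>

definition w_path ::
  "('a, 'b) pre_digraph \<Rightarrow> ('c, 'd) pre_digraph \<Rightarrow> ('a, 'b, 'c, 'd) graph_map \<Rightarrow> 'd list \<Rightarrow>
   'b list \<Rightarrow> bool" where
  "w_path G D f w p \<longleftrightarrow>
     (\<exists>u v i j q.
        pre_digraph.awalk G u p v \<and> pre_digraph.awalk (circle (length w)) i q j \<and>
        map (emap f) p = map (emap (circle_map D w)) q \<and>
        map (vmap f) (pre_digraph.awalk_verts G u p) =
          map (vmap (circle_map D w)) (pre_digraph.awalk_verts (circle (length w)) i q) \<and>
        set q = arcs (circle (length w)) \<and>
        set (pre_digraph.awalk_verts (circle (length w)) i q) = verts (circle (length w)))"

text \<open>
  Meaningful when \<open>w\<close> is a primitive loop and \<open>p\<close> is a \<open>w\<close>-path; the exponent \<open>n\<close> is then unique.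
\<close>

definition w_length :: "('a, 'b, 'c, 'd) graph_map \<Rightarrow> 'd list \<Rightarrow> 'b list \<Rightarrow> nat" where
  "w_length f w p =
     (THE n. \<exists>w' w''. strict_suffix w' w \<and> strict_prefix w'' w \<and>
        map (emap f) p = w' @ concat (replicate n w) @ w'')"

definition Omega_ge ::
  "nat \<Rightarrow> ('a, 'b) pre_digraph \<Rightarrow> ('c, 'd) pre_digraph \<Rightarrow> ('a, 'b, 'c, 'd) graph_map \<Rightarrow> 'd list \<Rightarrow>
   ('a \<times> nat, 'b \<times> nat) pre_digraph" where
  "Omega_ge k G D f w =
     pre_digraph.Union (Omega G D f w)
       {C \<in> components (Omega G D f w).
          \<exists>x p y. pre_digraph.awalk C x p y \<and>
            w_path G D f w (map fst p) \<and> k \<le> w_length f w (map fst p)}"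

end

theory Submission
  imports Defs
begin

text \<open>
  Let \<open>n\<close> be the length of \<open>w\<close>. A component of \<open>Omega_ge 3\<close> contains a path of length at
  least \<open>3 n\<close>. By primitivity a word of length \<open>n\<close> is read along the circle from one position only, so
  a component is determined by the image in \<open>\<Gamma>\<close> of any of its paths of length \<open>n\<close>. Order the positions
  of \<open>w\<close> lexicographically by the rotations starting there, and let \<open>m\<close> be the largest one. Reading a
  common letter preserves the order, so two lifts of the same path that both visit \<open>m\<close> coincide,
  however short the path is.

  Consider a visit to \<open>m\<close> in the middle third of the path. If the path meets \<open>Vbar\<close> both before and
  after that visit, it lifts a whole unbranched segment so that the lift visits \<open>m\<close>. Otherwise the
  component contains a path of length \<open>n\<close> avoiding \<open>Vbar\<close>; as the component is connected and
  meets \<open>Vbar\<close>, this path extends inside it until it reaches \<open>Vbar\<close>, so the component contains a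
  lift of an initial or of a terminal stretch of length at least \<open>n\<close> of a segment. The first arc of
  the segment in the whole and initial cases, and the last arc in the terminal case, determines the
  component. There are as many arcs leaving \<open>Vbar\<close> as arcs entering it, and each arc leaving
  \<open>Vbar\<close> starts a segment.
\<close>

section \<open>Components\<close>

text \<open>Trades undirected walks for vertex sets closed under adjacency. A closed set contains
  every symmetric walk starting in it, and conversely the vertices reachable from a fixed vertex of
  the symmetrised graph form a closed set.\<close>

lemma connected_iff_closed:
  assumes "wf_digraph H"
  shows "connected H \<longleftrightarrow> verts H \<noteq> {} \<and>
    (\<forall>X \<subseteq> verts H. X \<noteq> {} \<and> (\<forall>a\<in>arcs H. tail H a \<in> X \<longleftrightarrow> head H a \<in> X) \<longrightarrow> X = verts H)"
    (is "_ \<longleftrightarrow> _ \<and> (\<forall>X \<subseteq> _. ?closed X \<longrightarrow> _)")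
proof -
  interpret wf_digraph H by fact
  show ?thesis
  proof (intro iffI conjI allI impI)
    assume conn: "connected H"
    then show "verts H \<noteq> {}"
      by (auto simp: connected_def strongly_connected_def)
    fix X assume X: "X \<subseteq> verts H" "?closed X"
    then obtain u where u: "u \<in> X" by auto
    have "v \<in> X" if "v \<in> verts H" for v
    proof -
      have "u \<rightarrow>\<^sup>*\<^bsub>mk_symmetric H\<^esub> v"
        using conn u X that by (auto simp: connected_def strongly_connected_def)
      then have "(u, v) \<in> (arcs_ends (mk_symmetric H))\<^sup>*"
        by (rule reachable_rtranclI)
      then show ?thesis
      proof (induct rule: rtrancl_induct)
        case base
        then show ?case using u by simp
      next
        case (step x y)
        then obtain a where "a \<in> arcs H" "(tail H a = x \<and> head H a = y) \<or> (tail H a = y \<and> head H a = x)"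
          by (auto simp: parcs_mk_symmetric)
        then show ?case using X(2) step(3) by auto
      qed
    qed
    then show "X = verts H" using X by auto
  next
    assume *: "verts H \<noteq> {} \<and> (\<forall>X \<subseteq> verts H. ?closed X \<longrightarrow> X = verts H)"
    interpret S: pair_wf_digraph "mk_symmetric H" ..
    have W: "wf_digraph (with_proj (mk_symmetric H))" by unfold_locales
    show "connected H"
    proof (rule connectedI)
      show "verts H \<noteq> {}" using * by simp
      fix u v assume u: "u \<in> verts H" and v: "v \<in> verts H"
      define X where "X = {v. u \<rightarrow>\<^sup>*\<^bsub>mk_symmetric H\<^esub> v}"
      have "X \<subseteq> verts H"
        using S.reachable_in_verts(2) by (auto simp: X_def)
      moreover have "u \<in> X" using u by (auto simp: X_def)
      moreover have "tail H a \<in> X \<longleftrightarrow> head H a \<in> X" if "a \<in> arcs H" for a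
      proof -
        have "tail H a \<rightarrow>\<^bsub>mk_symmetric H\<^esub> head H a" "head H a \<rightarrow>\<^bsub>mk_symmetric H\<^esub> tail H a"
          using that by (auto simp: parcs_mk_symmetric)
        then show ?thesis
          unfolding X_def using wf_digraph.reachable_adj_trans[OF W] by simp meson
      qed
      ultimately have "X = verts H" using * by blast
      then show "u \<rightarrow>\<^sup>*\<^bsub>mk_symmetric H\<^esub> v" using v by (auto simp: X_def)
    qed
  qed
qed

lemma connected_union:
  assumes "connected H" "connected K" "wf_digraph H" "wf_digraph K" "compatible H K"
    and "verts H \<inter> verts K \<noteq> {}"
  shows "connected (union H K)"
proof -
  have wf: "wf_digraph (union H K)" using assms by (auto intro: wellformed_union)
  have th: "tail K = tail H" "head K = head H" using assms(5) by (auto simp: compatible_def)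
  have *: "X = verts H \<union> verts K"
    if X: "X \<subseteq> verts H \<union> verts K" "X \<noteq> {}" "\<forall>a\<in>arcs H \<union> arcs K. tail H a \<in> X \<longleftrightarrow> head H a \<in> X" for X
  proof -
    \<comment> \<open>\<open>X \<inter> verts H\<close> is closed in \<open>H\<close>, because both
      ends of an arc of \<open>H\<close> lie in \<open>verts H\<close>. A closed set meeting one
      part thus swallows it, and the common vertex carries it into the other part.\<close>
    have H: "X \<inter> verts H \<noteq> {} \<Longrightarrow> verts H \<subseteq> X"
      using assms(1)[unfolded connected_iff_closed[OF assms(3)]] X(3) wf_digraph.wellformed[OF assms(3)]
      by (metis Int_lower2 Un_iff IntE IntI inf.absorb_iff2)
    have K: "X \<inter> verts K \<noteq> {} \<Longrightarrow> verts K \<subseteq> X"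
      using assms(2)[unfolded connected_iff_closed[OF assms(4)]] X(3) wf_digraph.wellformed[OF assms(4)]
        th by (metis Int_lower2 Un_iff IntE IntI inf.absorb_iff2)
    show ?thesis using H K X(1,2) assms(6) by blast
  qed
  show ?thesis
    unfolding connected_iff_closed[OF wf] using * assms(6) by (simp add: th) auto
qed

context
  fixes P C :: "('a, 'b) pre_digraph"
  assumes C: "C \<in> components P"
begin

lemma component_subgraph: "subgraph C P"
  using C by (simp add: components_def pre_digraph.max_subgraph_def)

lemma component_connected: "connected C"
  using C by (simp add: components_def pre_digraph.max_subgraph_def)

lemma component_wf: "wf_digraph C"
  using component_subgraph by (simp add: subgraph_def)

lemma component_tail: "tail C = tail P" and component_head: "head C = head P"
  using component_subgraph by (auto simp: subgraph_def compatible_def)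

text \<open>The union of \<open>C\<close> and \<open>K\<close> is again a connected subgraph of
  \<open>P\<close>, so maximality of \<open>C\<close> makes it equal to \<open>C\<close>.\<close>

lemma component_absorbs:
  assumes "subgraph K P" "connected K" "verts C \<inter> verts K \<noteq> {}"
  shows "subgraph K C"
proof -
  have K: "compatible C K" "wf_digraph K"
    using assms(1) component_subgraph by (auto simp: compatible_def subgraph_def)
  have "connected (union C K)"
    using component_connected assms(2,3) component_wf K by (intro connected_union)
  moreover have "subgraph (union C K) P"
    using component_subgraph assms(1) by (intro subgraph_union) (auto simp: subgraph_def compatible_def)
  moreover have "subgraph C (union C K)"
    using component_wf K by (intro subgraphs_of_union)
  ultimately have "union C K = C"
    using C by (auto simp: components_def pre_digraph.max_subgraph_def)
  then show ?thesis
    using subgraphs_of_union(2)[OF component_wf K(2) K(1)] by simp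
qed

end

lemma components_eq_if_common_vert:
  assumes "C \<in> components P" "D \<in> components P" "v \<in> verts C" "v \<in> verts D"
  shows "C = D"
proof -
  have "subgraph C D" "subgraph D C"
    using assms component_absorbs component_subgraph component_connected by blast+
  then show ?thesis
    by (intro pre_digraph.equality) (auto simp: subgraph_def compatible_def)
qed

text \<open>Lets components of \<open>Omega\<close> and \<open>Omega_ge\<close> be treated as
  components of the fibre product. A component of the union shares a vertex with some member of
  \<open>S\<close>; both are connected subgraphs of \<open>P\<close> and of the union, so each
  absorbs the other.\<close>

lemma components_Union_subset:
  assumes "S \<subseteq> components P"
  shows "components (pre_digraph.Union P S) \<subseteq> S"
proof
  let ?U = "pre_digraph.Union P S"
  fix C assume C: "C \<in> components ?U"
  from component_connected[OF C] component_subgraph[OF C]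
  obtain v where v: "v \<in> verts C" "v \<in> verts ?U"
    by (auto simp: connected_def strongly_connected_def subgraph_def)
  then obtain K where K: "K \<in> S" "v \<in> verts K"
    by (auto simp: pre_digraph.Union_def)
  have KP: "K \<in> components P" using K assms by auto
  have wfP: "wf_digraph P" using component_subgraph[OF KP] by (simp add: subgraph_def)
  have wfU: "wf_digraph ?U" using component_subgraph[OF C] by (simp add: subgraph_def)
  have "subgraph ?U P"
    using wfP wfU assms component_subgraph[of _ P]
    by (fastforce simp: subgraph_def pre_digraph.Union_def compatible_def)
  then have "subgraph C P"
    using component_subgraph[OF C] by (auto simp: subgraph_def compatible_def)
  then have "subgraph C K"
    using component_absorbs[OF KP] component_connected[OF C] v K by blast
  moreover have "subgraph K ?U"
    using component_subgraph[OF KP] wfU K(1)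
    by (auto simp: subgraph_def pre_digraph.Union_def compatible_def)
  then have "subgraph K C"
    using component_absorbs[OF C] component_connected[OF KP] v K by blast
  ultimately have "C = K"
    by (intro pre_digraph.equality) (auto simp: subgraph_def compatible_def)
  then show "C \<in> S" using K by simp
qed

section \<open>Unbranched segments\<close>

context fin_digraph
begin

text \<open>Every class comes from a duplicate-free word over the finite set of arcs. Finiteness of
  the target is what lets an injection into \<open>Ebar G\<close> bound a cardinality.\<close>

lemma finite_Ebar: "finite (Ebar G)"
proof -
  have fin: "finite {p. distinct p \<and> set p \<subseteq> arcs G}"
    using finite_subset_distinct[OF finite_arcs] by (simp add: conj_commute)
  have "{{p} | p. unbranched_segment G p} \<subseteq> (\<lambda>p. {p}) ` {p. distinct p \<and> set p \<subseteq> arcs G}"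
    by (auto simp: unbranched_segment_def trail_def awalk_def)
  moreover have "{{rotate k p | k. True} | p. unbranched_cycle G p} \<subseteq>
      (\<lambda>p. {rotate k p | k. True}) ` {p. distinct p \<and> set p \<subseteq> arcs G}"
    by (auto simp: unbranched_cycle_def trail_def awalk_def)
  ultimately show ?thesis
    unfolding Ebar_def using fin by (meson finite_UnI finite_imageI finite_subset)
qed

lemma out_arc_unique:
  assumes "a \<in> arcs G" "b \<in> arcs G" "tail G a = tail G b" "tail G a \<notin> Vbar G"
  shows "a = b"
proof -
  have "card (out_arcs G (tail G a)) = 1"
    using assms tail_in_verts by (auto simp: Vbar_def out_degree_def)
  then obtain c where "out_arcs G (tail G a) = {c}" by (auto simp: card_1_singleton_iff)
  moreover have "a \<in> out_arcs G (tail G a)" "b \<in> out_arcs G (tail G a)" using assms by auto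
  ultimately show ?thesis by (metis singletonD)
qed

lemma in_arc_unique:
  assumes "a \<in> arcs G" "b \<in> arcs G" "head G a = head G b" "head G a \<notin> Vbar G"
  shows "a = b"
proof -
  have "card (in_arcs G (head G a)) = 1"
    using assms head_in_verts by (auto simp: Vbar_def in_degree_def)
  then obtain c where "in_arcs G (head G a) = {c}" by (auto simp: card_1_singleton_iff)
  moreover have "a \<in> in_arcs G (head G a)" "b \<in> in_arcs G (head G a)" using assms by auto
  ultimately show ?thesis by (metis singletonD)
qed

lemma ex_out_arc:
  assumes "v \<in> verts G" "v \<notin> Vbar G"
  shows "\<exists>a\<in>arcs G. tail G a = v"
proof -
  have "out_degree G v = 1" using assms by (simp add: Vbar_def)
  then obtain c where "out_arcs G v = {c}" by (auto simp: out_degree_def card_1_singleton_iff)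
  then have "c \<in> out_arcs G v" by blast
  then show ?thesis by auto
qed

lemma ex_in_arc:
  assumes "v \<in> verts G" "v \<notin> Vbar G"
  shows "\<exists>a\<in>arcs G. head G a = v"
proof -
  have "in_degree G v = 1" using assms by (simp add: Vbar_def)
  then obtain c where "in_arcs G v = {c}" by (auto simp: in_degree_def card_1_singleton_iff)
  then have "c \<in> in_arcs G v" by blast
  then show ?thesis by auto
qed

text \<open>Compare complements in the set of all arcs: away from \<open>Vbar\<close> each vertex
  has exactly one arc out and one arc in, so both complements are in bijection with
  \<open>verts G - Vbar G\<close>.\<close>

lemma card_arcs_from_Vbar_eq_card_arcs_to_Vbar:
  "card {a \<in> arcs G. tail G a \<in> Vbar G} = card {a \<in> arcs G. head G a \<in> Vbar G}"
proof -
  have "bij_betw (tail G) {a \<in> arcs G. tail G a \<notin> Vbar G} (verts G - Vbar G)"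
    using ex_out_arc out_arc_unique tail_in_verts
    by (intro bij_betw_imageI inj_onI) (auto simp: image_iff)
  moreover have "bij_betw (head G) {a \<in> arcs G. head G a \<notin> Vbar G} (verts G - Vbar G)"
    using ex_in_arc in_arc_unique head_in_verts
    by (intro bij_betw_imageI inj_onI) (auto simp: image_iff)
  ultimately have "card {a \<in> arcs G. tail G a \<notin> Vbar G} = card {a \<in> arcs G. head G a \<notin> Vbar G}"
    by (auto dest!: bij_betw_same_card)
  moreover have "card {a \<in> arcs G. Q a} + card {a \<in> arcs G. \<not> Q a} = card (arcs G)" for Q
    using finite_arcs by (subst card_Un_disjoint[symmetric]) (auto intro: arg_cong[of _ _ card])
  ultimately show ?thesis
    by (metis (mono_tags) add_right_cancel)
qed

text \<open>A trail of maximal length among those with no inner vertex in \<open>Vbar\<close> is a segment: its last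
  vertex cannot have a single arc in and a single arc out, one of which is already used up.\<close>

lemma ex_segment_from:
  assumes "a \<in> arcs G" "tail G a \<in> Vbar G"
  shows "\<exists>p. unbranched_segment G p \<and> hd p = a"
proof -
  define Q where "Q p \<longleftrightarrow> p \<noteq> [] \<and> hd p = a \<and> distinct p \<and>
    (\<exists>v. awalk (tail G a) p v) \<and> (\<forall>b\<in>set (tl p). tail G b \<notin> Vbar G)" for p
  have "Q [a]"
    using assms by (auto simp: Q_def awalk_simps)
  \<comment> \<open>Distinctness bounds the length by the number of arcs, so a longest such trail
    exists.\<close>
  moreover have "length p < Suc (card (arcs G))" if "Q p" for p
  proof -
    have "length p = card (set p)" using that by (auto simp: Q_def distinct_card)
    also have "\<dots> \<le> card (arcs G)"
      using that by (intro card_mono finite_arcs) (auto simp: Q_def awalk_def)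
    finally show ?thesis by simp
  qed
  ultimately obtain p where p: "Q p" and max: "\<And>q. Q q \<Longrightarrow> length q \<le> length p"
    using ex_has_greatest_nat[of Q "[a]" length] by blast
  from p obtain v where aw: "awalk (tail G a) p v" by (auto simp: Q_def)
  have p0: "p \<noteq> []" and hd: "hd p = a" and dist: "distinct p"
    and inner: "\<And>b. b \<in> set (tl p) \<Longrightarrow> tail G b \<notin> Vbar G"
    using p by (auto simp: Q_def)
  have sub: "set p \<subseteq> arcs G" using aw by (auto simp: awalk_def)
  have v: "v = head G (last p)"
    using awlast_of_awalk[OF aw] p0 by (simp add: awalk_verts_conv)
  have "v \<in> Vbar G"
  proof (rule ccontr)
    assume nv: "v \<notin> Vbar G"
    obtain c where c: "c \<in> arcs G" "tail G c = v"
      using ex_out_arc nv awalk_last_in_verts[OF aw] by blast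
    have "c \<in> set p"
    proof (rule ccontr)
      assume "c \<notin> set p"
      moreover have "awalk (tail G a) (p @ [c]) (head G c)"
        using aw c awalk_last_in_verts[OF aw] by (auto simp: awalk_simps)
      ultimately have "Q (p @ [c])"
        using p c nv by (auto simp: Q_def)
      then show False using max by fastforce
    qed
    \<comment> \<open>The arc \<open>c\<close> is not the first one, since \<open>a\<close> leaves
      \<open>Vbar\<close>. Its predecessor in \<open>p\<close> and the last arc of \<open>p\<close>
      both enter \<open>v\<close>, hence are equal, against distinctness.\<close>
    then obtain ys zs where split: "p = ys @ c # zs" by (auto simp: in_set_conv_decomp)
    have "ys \<noteq> []" using split hd c nv assms(2) by auto
    then have "head G (last ys) = v"
      using aw c(2) split by (auto simp: awalk_simps awalk_verts_conv)
    then have "last ys = last p"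
      using v nv sub \<open>ys \<noteq> []\<close> p0 by (intro in_arc_unique) (auto simp: split)
    moreover have "last ys \<in> set ys" using \<open>ys \<noteq> []\<close> by simp
    moreover have "last p \<in> set (c # zs)"
      using last_in_set[of "c # zs"] by (simp add: \<open>p = ys @ c # zs\<close> del: last.simps)
    moreover have "set ys \<inter> set (c # zs) = {}" using dist unfolding split by auto
    ultimately show False by (metis disjoint_iff)
  qed
  moreover have "set (butlast (tl (awalk_verts (tail G a) p))) \<inter> Vbar G = {}"
    using inner p0 by (cases p) (auto simp: awalk_verts_conv simp flip: butlast_append)
  ultimately have "unbranched_segment G p"
    using p0 assms(2) aw dist by (auto simp: unbranched_segment_def trail_def)
  then show ?thesis using hd by blast
qed

text \<open>A segment remembers the arc it starts with as its head, so choosing a segment for each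
  arc is injective.\<close>

lemma card_arcs_from_Vbar_le: "card {a \<in> arcs G. tail G a \<in> Vbar G} \<le> card (Ebar G)"
proof -
  obtain s where s: "\<And>a. a \<in> arcs G \<Longrightarrow> tail G a \<in> Vbar G \<Longrightarrow> unbranched_segment G (s a) \<and> hd (s a) = a"
    using ex_segment_from by metis
  show ?thesis
    using s by (intro card_inj_on_le[where f = "\<lambda>a. {s a}"] finite_Ebar)
      (auto simp: inj_on_def Ebar_def, metis)
qed

end

section \<open>Primitive words\<close>

definition primitive_word :: "'d list \<Rightarrow> bool" where
  "primitive_word w \<longleftrightarrow> (\<forall>u k. 2 \<le> k \<longrightarrow> w \<noteq> concat (replicate k u))"

lemma primitive_word_nonempty: "primitive_word w \<Longrightarrow> w \<noteq> []"
  by (auto simp: primitive_word_def intro!: exI[of _ 2] exI[of _ "[]"])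

text \<open>A root of \<open>w\<close> is a prefix of \<open>w\<close>, hence automatically a path
  in the graph.\<close>

lemma primitive_word_if_primitive_path:
  assumes "wf_digraph G" "is_loop G w" "primitive_path G w"
  shows "primitive_word w"
  unfolding primitive_word_def
proof (intro allI impI notI)
  interpret wf_digraph G by fact
  fix u and k :: nat assume k: "2 \<le> k" "w = concat (replicate k u)"
  then obtain m where "w = u @ concat (replicate m u)" by (cases k) auto
  then have "\<exists>x y. awalk x u y"
    using assms(2) by (auto simp: is_loop_def)
  then show False using k assms(3) by (auto simp: primitive_path_def)
qed

lemma nth_concat_replicate:
  "k < m * length w \<Longrightarrow> concat (replicate m w) ! k = w ! (k mod length w)"
proof (induction m arbitrary: k)
  case (Suc m)
  then show ?case
    by (cases "k < length w") (auto simp: nth_append le_mod_geq)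
qed simp

lemma length_concat_replicate: "length (concat (replicate m w)) = m * length w"
  by (induction m) auto

text \<open>A fixed rotation makes the two pieces of \<open>w\<close> commute, and commuting words
  are powers of a common word. Both pieces are nonempty when \<open>d\<close> is nonzero, so
  \<open>w\<close> would be a power with exponent at least 2.\<close>

lemma rotate_primitive:
  assumes "primitive_word w" "d < length w" "rotate d w = w"
  shows "d = 0"
proof (rule ccontr)
  assume "d \<noteq> 0"
  have "drop d w @ take d w = w"
    using assms(2,3) by (simp add: rotate_drop_take)
  then have "drop d w @ take d w = take d w @ drop d w" by simp
  then obtain m n zs where *: "concat (replicate m zs) = drop d w" "concat (replicate n zs) = take d w"
    by (meson comm_append_are_replicate)
  have "m \<noteq> 0" "n \<noteq> 0" using * \<open>d \<noteq> 0\<close> assms(2) by (auto intro!: Nat.gr0I)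
  then have "2 \<le> n + m" by simp
  moreover have "w = concat (replicate (n + m) zs)"
    using * by (simp add: replicate_add)
  ultimately show False using assms(1) by (auto simp: primitive_word_def)
qed

text \<open>Equal cyclic readings from \<open>i\<close> and \<open>j\<close> mean that rotating
  \<open>w\<close> by the difference fixes it.\<close>

lemma primitive_word_sync:
  assumes "primitive_word w" "i < length w" "j < length w"
    and "\<And>k. k < length w \<Longrightarrow> w ! ((i + k) mod length w) = w ! ((j + k) mod length w)"
  shows "i = j"
  using assms(2-4)
proof (induction i j rule: linorder_wlog)
  case (le i j)
  let ?n = "length w"
  have "rotate (j - i) w = w"
  proof (rule nth_equalityI)
    fix k assume "k < length (rotate (j - i) w)"
    then have k: "k < ?n" by simp
    \<comment> \<open>Chosen so that reading \<open>l\<close> letters on from \<open>i\<close> lands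
      at \<open>k\<close>; the added length keeps the subtraction from truncating.\<close>
    define l where "l = (k + (?n - i)) mod ?n"
    have "l < ?n" unfolding l_def using k by (intro mod_less_divisor) linarith
    moreover have "(i + l) mod ?n = k"
      using k le(2) by (simp add: l_def mod_add_right_eq)
    moreover have "(j + l) mod ?n = (k + (j - i)) mod ?n"
    proof -
      have "j + (k + (?n - i)) = k + (j - i) + ?n" using le(1,2) by simp
      then show ?thesis unfolding l_def by (metis mod_add_right_eq mod_add_self2)
    qed
    ultimately show "rotate (j - i) w ! k = w ! k"
      using le(4)[of l] k by (simp add: nth_rotate add.commute[of k])
  qed simp
  then have "j - i = 0" using rotate_primitive[OF assms(1)] less_imp_diff_less[OF le(3)] by blast
  then show ?case using le(1) by simp
next
  case (sym i j)
  then show ?case by metis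
qed

text \<open>Reading the rotation of \<open>w\<close> that starts at \<open>i\<close> as a number in base \<open>B\<close> orders the positions of
  \<open>w\<close> lexicographically; moving one letter forward is then an affine map depending on the
  letter only.\<close>

lemma ex_lexicographic_rank:
  assumes "primitive_word w"
  shows "\<exists>(V :: nat \<Rightarrow> int) B. 0 < B \<and> inj_on V {..<length w} \<and>
    (\<forall>i<length w. \<forall>j<length w. w ! i = w ! j \<longrightarrow>
       V (Suc i mod length w) - V (Suc j mod length w) = B * (V i - V j))"
proof -
  let ?n = "length w"
  have n: "?n > 0" using primitive_word_nonempty[OF assms] by simp
  obtain m and f :: "_ \<Rightarrow> nat" where f: "f ` set w = {i. i < m}" "inj_on f (set w)"
    using finite_imp_inj_to_nat_seg[of "set w"] by auto
  define c where "c i = int (f (w ! (i mod ?n)))" for i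
  \<comment> \<open>Two more than the number of letters: digits are at most \<open>B - 2\<close>,
    which keeps every rank strictly below \<open>B ^ ?n - 1\<close>.\<close>
  define B where "B = int m + 2"
  define V where "V i = (\<Sum>k<?n. c (i + k) * B ^ (?n - 1 - k))" for i
  have c: "0 \<le> c i" "c i \<le> B - 2" for i
  proof -
    have "f (w ! (i mod ?n)) \<in> f ` set w" using n by simp
    then show "0 \<le> c i" "c i \<le> B - 2" using f by (auto simp: c_def B_def)
  qed
  have V_mod: "V (i mod ?n) = V i" for i
    by (simp add: V_def c_def mod_add_left_eq)
  \<comment> \<open>Multiplying by \<open>B\<close> shifts the digits; the leading digit
    \<open>c i\<close> then leaves from weight \<open>B ^ ?n\<close> and returns as the last digit,
    by cyclicity.\<close>
  have V_Suc: "V (Suc i) = B * V i - c i * (B ^ ?n - 1)" for i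
  proof -
    define g where "g k = c (i + k) * B ^ (?n - k)" for k
    have "B * V i = (\<Sum>k<?n. g k)"
      unfolding V_def g_def sum_distrib_left
    proof (intro sum.cong refl)
      fix k assume "k \<in> {..<?n}"
      then have "?n - k = Suc (?n - 1 - k)" by auto
      then show "B * (c (i + k) * B ^ (?n - 1 - k)) = c (i + k) * B ^ (?n - k)" by simp
    qed
    moreover have "V (Suc i) = (\<Sum>k<?n. g (Suc k))"
      by (simp add: V_def g_def)
    moreover have "(\<Sum>k<?n. g k) + g ?n = g 0 + (\<Sum>k<?n. g (Suc k))"
      using sum.lessThan_Suc_shift[of g ?n] by simp
    moreover have "g ?n = c i" by (simp add: g_def c_def)
    moreover have "g 0 = c i * B ^ ?n" by (simp add: g_def)
    ultimately show ?thesis by (simp add: algebra_simps)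
  qed
  have B: "B \<ge> 2" by (simp add: B_def)
  have V_nonneg: "0 \<le> V i" for i
    using c B by (auto simp: V_def intro!: sum_nonneg)
  have V_less: "V i < B ^ ?n - 1" for i
  proof -
    have "V i \<le> (\<Sum>k<?n. (B - 2) * B ^ (?n - 1 - k))"
      unfolding V_def using c B by (intro sum_mono mult_right_mono) auto
    also have "\<dots> = (B - 2) * (\<Sum>k<?n. B ^ k)"
      using sum.nat_diff_reindex[of "\<lambda>k. B ^ k" ?n] by (simp flip: sum_distrib_left)
    also have "\<dots> < (B - 1) * (\<Sum>k<?n. B ^ k)"
      using B n by (intro mult_strict_right_mono sum_pos) auto
    also have "\<dots> = B ^ ?n - 1"
      by (simp add: power_diff_1_eq)
    finally show ?thesis .
  qed
  \<comment> \<open>By the recurrence and the strict bound, \<open>c i\<close> is the quotient and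
    \<open>V (Suc i)\<close> the remainder of \<open>B * V i\<close> by \<open>B ^ ?n - 1\<close>.
    So the rank determines the letter and the next rank.\<close>
  have step: "c i = c j \<and> V (Suc i) = V (Suc j)" if "V i = V j" for i j
  proof -
    have "c i = (V (Suc i) + c i * (B ^ ?n - 1)) div (B ^ ?n - 1)" for i
      using V_nonneg[of "Suc i"] V_less[of "Suc i"] by (simp add: div_mult_self1)
    moreover have "V (Suc i) + c i * (B ^ ?n - 1) = B * V i" for i
      using V_Suc[of i] by simp
    ultimately have "c i = c j" using that by metis
    then show ?thesis using V_Suc that by simp
  qed
  have "inj_on V {..<?n}"
  proof (rule inj_onI)
    fix i j assume ij: "i \<in> {..<?n}" "j \<in> {..<?n}" "V i = V j"
    have "V (i + k) = V (j + k)" for k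
    proof (induction k)
      case (Suc k)
      then show ?case using step[OF Suc] by simp
    qed (simp add: ij)
    then have "c (i + k) = c (j + k)" for k using step by blast
    then have "w ! ((i + k) mod ?n) = w ! ((j + k) mod ?n)" for k
      using n by (intro inj_onD[OF f(2)]) (auto simp: c_def)
    then show "i = j" using ij(1,2) by (intro primitive_word_sync[OF assms]) simp_all
  qed
  moreover have "V (Suc i mod ?n) - V (Suc j mod ?n) = B * (V i - V j)"
    if "i < ?n" "j < ?n" "w ! i = w ! j" for i j
    using that V_Suc[of i] V_Suc[of j] by (simp add: V_mod c_def algebra_simps)
  ultimately show ?thesis using B by (intro exI[of _ V] exI[of _ B]) auto
qed

text \<open>A position of maximal rank works. Along a common reading the rank difference is scaled
  by powers of the positive number \<open>B\<close>; each of the two visits to the maximum, possibly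
  at different times, excludes one sign, so the difference is zero.\<close>

lemma ex_separating_position:
  assumes "primitive_word w"
  shows "\<exists>m<length w. \<forall>i<length w. \<forall>j<length w. \<forall>l.
    (\<forall>k<l. w ! ((i + k) mod length w) = w ! ((j + k) mod length w)) \<longrightarrow>
    (\<exists>k<l. (i + k) mod length w = m) \<longrightarrow> (\<exists>k<l. (j + k) mod length w = m) \<longrightarrow> i = j"
proof -
  let ?n = "length w"
  have n: "?n > 0" using primitive_word_nonempty[OF assms] by simp
  obtain V :: "nat \<Rightarrow> int" and B where B: "0 < B" and inj: "inj_on V {..<?n}"
    and step: "\<And>i j. i < ?n \<Longrightarrow> j < ?n \<Longrightarrow> w ! i = w ! j \<Longrightarrow>
       V (Suc i mod ?n) - V (Suc j mod ?n) = B * (V i - V j)"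
    using ex_lexicographic_rank[OF assms] by blast
  have "Max (V ` {..<?n}) \<in> V ` {..<?n}" using n by (intro Max_in) auto
  then obtain m where m: "m < ?n" "Max (V ` {..<?n}) = V m" by auto
  have max: "V i \<le> V m" if "i < ?n" for i
    unfolding m(2)[symmetric] using that by (intro Max_ge) auto
  have "i = j" if ij: "i < ?n" "j < ?n"
    and eq: "\<And>k. k < l \<Longrightarrow> w ! ((i + k) mod ?n) = w ! ((j + k) mod ?n)"
    and k1: "k1 < l" "(i + k1) mod ?n = m" and k2: "k2 < l" "(j + k2) mod ?n = m" for i j l k1 k2
  proof -
    have V: "V ((i + k) mod ?n) - V ((j + k) mod ?n) = B ^ k * (V i - V j)" if "k < l" for k
      using that
    proof (induction k)
      case (Suc k)
      have "V (Suc ((i + k) mod ?n) mod ?n) - V (Suc ((j + k) mod ?n) mod ?n) =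
          B * (V ((i + k) mod ?n) - V ((j + k) mod ?n))"
        using n Suc.prems by (intro step eq) auto
      then show ?case using Suc by (simp add: mod_Suc_eq algebra_simps)
    qed (use ij in simp)
    have "0 \<le> B ^ k1 * (V i - V j)"
      using V[OF k1(1)] k1(2) max[of "(j + k1) mod ?n"] n by simp
    moreover have "B ^ k2 * (V i - V j) \<le> 0"
      using V[OF k2(1)] k2(2) max[of "(i + k2) mod ?n"] n by simp
    moreover have "0 < B ^ k1" "0 < B ^ k2" using B by auto
    ultimately have "V i = V j"
      by (auto simp: zero_le_mult_iff mult_le_0_iff)
    then show ?thesis using inj ij by (auto dest: inj_onD)
  qed
  then show ?thesis using m(1) by (intro exI[of _ m]) blast
qed

section \<open>Words of the form suffix, power, prefix\<close>

text \<open>Translates such a decomposition into reading around the circle: the suffix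
  \<open>w'\<close> fixes the starting position. For empty \<open>w'\<close> the start is the full
  length, which reduces to 0.\<close>

lemma word_of_power_nth:
  assumes "strict_suffix w' w" "strict_prefix w'' w"
    and "k < length (w' @ concat (replicate m w) @ w'')"
  shows "(w' @ concat (replicate m w) @ w'') ! k = w ! ((length w - length w' + k) mod length w)"
proof -
  let ?n = "length w"
  obtain v where v: "w = v @ w'" using assms(1) by (auto simp: strict_suffix_def suffix_def)
  obtain z where z: "w = w'' @ z" "z \<noteq> []" using assms(2) by (auto simp: strict_prefix_def prefix_def)
  consider "k < length w'" | "length w' \<le> k" "k < length w' + m * ?n" |
     "length w' + m * ?n \<le> k" "k < length w' + m * ?n + length w''"
    using assms(3) by (auto simp: length_concat_replicate) linarith
  then show ?thesis
  proof cases
    case 1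
    then have "(length w - length w' + k) mod length w = length v + k"
      using v by simp
    then show ?thesis using 1 by (simp add: nth_append v)
  next
    case 2
    have "?n - length w' + k = (k - length w') + ?n" using 2 v by simp
    then have "(?n - length w' + k) mod ?n = (k - length w') mod ?n" by simp
    moreover have "k - length w' < m * ?n" using 2 by linarith
    ultimately show ?thesis
      using 2 by (simp add: nth_append length_concat_replicate nth_concat_replicate)
  next
    case 3
    have "?n - length w' + k = (k - length w' - m * ?n) + ?n * (m + 1)" using 3 v by simp
    then have "(?n - length w' + k) mod ?n = (k - length w' - m * ?n) mod ?n"
      by (metis mod_mult_self2)
    also have "\<dots> = k - length w' - m * ?n" using 3 z by simp
    finally have "(?n - length w' + k) mod ?n = k - length w' - m * ?n" .
    moreover have "w ! (k - length w' - m * ?n) = w'' ! (k - length w' - m * ?n)"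
      using 3 by (subst z(1)) (simp add: nth_append less_diff_conv2)
    moreover have "\<not> k - length w' < m * ?n" using 3 by linarith
    ultimately show ?thesis
      using 3 by (simp add: nth_append length_concat_replicate)
  qed
qed

lemma ex_power_decomposition:
  assumes "w \<noteq> []" "i < length w" "length w \<le> length l"
    and "\<And>k. k < length l \<Longrightarrow> l ! k = w ! ((i + k) mod length w)"
  shows "\<exists>m w' w''. strict_suffix w' w \<and> strict_prefix w'' w \<and> l = w' @ concat (replicate m w) @ w''"
proof -
  let ?n = "length w"
  \<comment> \<open>At \<open>i = 0\<close> the suffix \<open>drop i w\<close> would be all of
    \<open>w\<close>, which is not proper, so the empty word is taken.\<close>
  define w' where "w' = (if i = 0 then [] else drop i w)"
  define r where "r = length l - length w'"
  define m where "m = r div ?n"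
  define w'' where "w'' = take (r mod ?n) w"
  have suf: "strict_suffix w' w"
    using assms(1,2) suffix_drop[of i w] by (auto simp: w'_def strict_suffix_def)
     (metis diff_less length_drop length_greater_0_conv less_irrefl)
  have "length w'' < ?n" using assms(1) by (simp add: w''_def)
  then have pre: "strict_prefix w'' w"
    by (auto simp: w''_def strict_prefix_def take_is_prefix)
  have lw': "length w' \<le> length l" "(?n - length w') mod ?n = i"
    using assms(2,3) by (auto simp: w'_def)
  have len: "length (w' @ concat (replicate m w) @ w'') = length l"
  proof -
    have "r mod ?n < ?n" using assms(1) by simp
    then have "m * ?n + length w'' = r" by (simp add: m_def w''_def)
    then show ?thesis using lw' by (simp add: r_def length_concat_replicate)
  qed
  have "l = w' @ concat (replicate m w) @ w''"
  proof (rule nth_equalityI)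
    fix k assume "k < length l"
    then show "l ! k = (w' @ concat (replicate m w) @ w'') ! k"
      using word_of_power_nth[OF suf pre, of k m] assms(4)[of k] len lw'(2) by (metis mod_add_left_eq)
  qed (simp only: len)
  then show ?thesis using suf pre by blast
qed

text \<open>Justifies the definite description in \<open>w_length\<close>. As \<open>l\<close> is at
  least as long as \<open>w\<close>, synchronisation gives both decompositions the same start, so
  \<open>w'\<close> and \<open>v'\<close> have equal length; both exponents are then the quotient of
  the remaining length by that of \<open>w\<close>.\<close>

lemma power_decomposition_unique:
  assumes "primitive_word w" "length w \<le> length l"
    and "strict_suffix w' w" "strict_prefix w'' w" "l = w' @ concat (replicate m w) @ w''"
    and "strict_suffix v' w" "strict_prefix v'' w" "l = v' @ concat (replicate k w) @ v''"
  shows "k = m"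
proof -
  let ?n = "length w"
  have n: "?n > 0" using primitive_word_nonempty[OF assms(1)] by simp
  have less: "length w' < ?n" "length v' < ?n" "length w'' < ?n" "length v'' < ?n"
    using assms(3,4,6,7) by (auto intro: suffix_length_less prefix_length_less)
  have "(?n - length w') mod ?n = (?n - length v') mod ?n"
  proof (rule primitive_word_sync[OF assms(1)])
    fix j assume "j < ?n"
    then show "w ! (((?n - length w') mod ?n + j) mod ?n) = w ! (((?n - length v') mod ?n + j) mod ?n)"
      using word_of_power_nth[OF assms(3,4), of j m] word_of_power_nth[OF assms(6,7), of j k] assms(2,5,8)
      by (metis mod_add_left_eq order_less_le_trans)
  qed (use n in auto)
  then have w'v': "length w' = length v'"
    using less(1,2) by (simp add: mod_if split: if_splits)
  have "length w' + (m * ?n + length w'') = length v' + (k * ?n + length v'')"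
    using arg_cong[OF assms(5), of length] arg_cong[OF assms(8), of length]
    by (simp add: length_concat_replicate)
  then have "(length w'' + m * ?n) div ?n = (length v'' + k * ?n) div ?n"
    using w'v' by (simp add: add.commute)
  then show ?thesis
    using less(3,4) n by (simp only: div_mult_self1 div_less neq0_conv)
qed

section \<open>Chains of arcs in the fibre product\<close>

text \<open>A walk kept as a bare list of arcs, so that taking pieces or adding an arc requires no
  bookkeeping of end vertices.\<close>

definition chain :: "('a, 'b) pre_digraph \<Rightarrow> 'b list \<Rightarrow> bool" where
  "chain H p \<longleftrightarrow> set p \<subseteq> arcs H \<and>
    (\<forall>k. Suc k < length p \<longrightarrow> head H (p ! k) = tail H (p ! Suc k))"

lemma chain_if_awalk:
  assumes "pre_digraph.awalk H u p v"
  shows "chain H p"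
proof -
  have "\<forall>k. Suc k < length p \<longrightarrow> head H (p ! k) = tail H (p ! Suc k)"
    if "pre_digraph.cas H u p v"
    using that
  proof (induction p arbitrary: u)
    case (Cons a p)
    show ?case
    proof (intro allI impI)
      fix k assume k: "Suc k < length (a # p)"
      then show "head H ((a # p) ! k) = tail H ((a # p) ! Suc k)"
        using Cons by (cases p; cases k) (auto simp: pre_digraph.cas.simps)
    qed
  qed simp
  then show ?thesis using assms by (auto simp: chain_def pre_digraph.awalk_def)
qed

lemma chain_take: "chain H p \<Longrightarrow> chain H (take k p)"
  using set_take_subset[of k p] by (auto simp: chain_def)

lemma chain_drop: "chain H p \<Longrightarrow> chain H (drop k p)"
  using set_drop_subset[of k p] by (auto simp: chain_def)

lemma chain_snoc:
  assumes "chain H p" "p \<noteq> []" "a \<in> arcs H" "tail H a = head H (last p)"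
  shows "chain H (p @ [a])"
  unfolding chain_def
proof (intro conjI allI impI)
  fix k assume "Suc k < length (p @ [a])"
  then have "Suc k < length p \<or> k = length p - 1" by auto
  then show "head H ((p @ [a]) ! k) = tail H ((p @ [a]) ! Suc k)"
    using assms by (auto simp: chain_def nth_append last_conv_nth)
qed (use assms in \<open>auto simp: chain_def\<close>)

lemma chain_Cons:
  assumes "chain H p" "p \<noteq> []" "a \<in> arcs H" "head H a = tail H (hd p)"
  shows "chain H (a # p)"
  unfolding chain_def
proof (intro conjI allI impI)
  fix k assume "Suc k < length (a # p)"
  then show "head H ((a # p) ! k) = tail H ((a # p) ! Suc k)"
    using assms by (cases k) (auto simp: chain_def hd_conv_nth)
qed (use assms in \<open>auto simp: chain_def\<close>)

locale loop_fibre_product = fin_digraph G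
  for G :: "('a, 'b) pre_digraph" +
  fixes D :: "('c, 'd) pre_digraph" and \<gamma> :: "('a, 'b, 'c, 'd) graph_map" and w :: "'d list"
  assumes prim: "primitive_word w"
begin

abbreviation P where
  "P \<equiv> fibre_product G \<gamma> (circle (length w)) (circle_map D w)"

lemma w_pos: "0 < length w"
  using primitive_word_nonempty[OF prim] by simp

lemma arcs_P: "a \<in> arcs P \<longleftrightarrow> fst a \<in> arcs G \<and> snd a < length w \<and> emap \<gamma> (fst a) = w ! snd a"
  by (auto simp: fibre_product_def circle_def circle_map_def case_prod_unfold)

context
  fixes C
  assumes C: "C \<in> components P"
begin

lemma arcs_component:
  assumes "a \<in> arcs C"
  shows "fst a \<in> arcs G" "snd a < length w" "emap \<gamma> (fst a) = w ! snd a"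
proof -
  have "a \<in> arcs P" using assms component_subgraph[OF C] by (auto simp: subgraph_def)
  then show "fst a \<in> arcs G" "snd a < length w" "emap \<gamma> (fst a) = w ! snd a"
    using arcs_P by blast+
qed

lemma tail_C: "tail C a = (tail G (fst a), snd a)"
  by (cases a) (simp add: component_tail[OF C] fibre_product_def circle_def)

lemma head_C: "head C a = (head G (fst a), Suc (snd a) mod length w)"
  by (cases a) (simp add: component_head[OF C] fibre_product_def circle_def)

lemma arc_in_component:
  assumes "a \<in> arcs C"
  shows "tail C a \<in> verts C" "head C a \<in> verts C"
  using assms wf_digraph.wellformed[OF component_wf[OF C]] by auto

lemma chain_arc: "chain C p \<Longrightarrow> k < length p \<Longrightarrow> p ! k \<in> arcs C"
  by (auto simp: chain_def)

lemma chain_step: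
  assumes "chain C p" "Suc k < length p"
  shows "tail G (fst (p ! Suc k)) = head G (fst (p ! k))"
    and "snd (p ! Suc k) = Suc (snd (p ! k)) mod length w"
  using assms tail_C head_C by (auto simp: chain_def dest!: spec[of _ k])

lemma chain_position:
  assumes "chain C p" "k < length p"
  shows "snd (p ! k) = (snd (p ! 0) + k) mod length w"
  using assms(2)
proof (induction k)
  case 0
  then show ?case using chain_arc[OF assms(1), of 0] arcs_component(2) by simp
next
  case (Suc k)
  then show ?case using chain_step(2)[OF assms(1), of k] by (simp add: mod_Suc_eq)
qed

lemma chain_letter:
  assumes "chain C p" "k < length p"
  shows "emap \<gamma> (fst (p ! k)) = w ! ((snd (p ! 0) + k) mod length w)"
  using chain_arc[OF assms] arcs_component(3) chain_position[OF assms] by simp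

end

text \<open>Surjectivity onto the circle forces the factoring path to use each of its arcs.\<close>

lemma w_path_length:
  assumes "w_path G D \<gamma> w p"
  shows "length w \<le> length p"
proof -
  obtain q where q: "map (emap \<gamma>) p = map (emap (circle_map D w)) q" "set q = arcs (circle (length w))"
    using assms by (auto simp: w_path_def)
  then have "length w = card (set q)" by (simp add: circle_def)
  also have "\<dots> \<le> length q" by (rule card_length)
  also have "\<dots> = length p" using q(1) by (metis length_map)
  finally show ?thesis .
qed

text \<open>A chain reads \<open>w\<close> cyclically from the circle position of its first arc, so
  a decomposition exists and is unique; its exponent counts disjoint copies of \<open>w\<close> in
  the word read.\<close>

lemma w_length_chain:
  assumes C: "C \<in> components P" and p: "chain C p" "length w \<le> length p"
  shows "w_length \<gamma> w (map fst p) * length w \<le> length p"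
proof -
  define l where "l = map (emap \<gamma>) (map fst p)"
  have p0: "0 < length p" using p(2) w_pos by linarith
  have "snd (p ! 0) < length w"
    using arcs_component(2)[OF C chain_arc[OF C p(1) p0]] .
  then obtain m w' w'' where m: "strict_suffix w' w" "strict_prefix w'' w"
    "l = w' @ concat (replicate m w) @ w''"
    using ex_power_decomposition[of w "snd (p ! 0)" l] p w_pos chain_letter[OF C p(1)]
    by (auto simp: l_def)
  have "w_length \<gamma> w (map fst p) = m"
    unfolding w_length_def l_def[symmetric]
  proof (rule the_equality)
    show "\<exists>w' w''. strict_suffix w' w \<and> strict_prefix w'' w \<and> l = w' @ concat (replicate m w) @ w''"
      using m by blast
  next
    fix k assume "\<exists>w' w''. strict_suffix w' w \<and> strict_prefix w'' w \<and> l = w' @ concat (replicate k w) @ w''"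
    then obtain v' v'' where "strict_suffix v' w" "strict_prefix v'' w" "l = v' @ concat (replicate k w) @ v''"
      by blast
    moreover have "length w \<le> length l" using p(2) by (simp add: l_def)
    ultimately show "k = m"
      using power_decomposition_unique[OF prim _ m] by blast
  qed
  moreover have "m * length w \<le> length l"
    using arg_cong[OF m(3), of length] by (simp add: length_concat_replicate)
  ultimately show ?thesis by (simp add: l_def)
qed

lemma chains_same_component:
  assumes C: "C \<in> components P" "C' \<in> components P" and p: "chain C p" "chain C' p'" "p \<noteq> []" "p' \<noteq> []"
    and "fst (p ! 0) = fst (p' ! 0)" "snd (p ! 0) = snd (p' ! 0)"
  shows "C = C'"
proof -
  have "p ! 0 = p' ! 0" using assms by (simp add: prod_eq_iff)
  moreover have "tail C (p ! 0) \<in> verts C" "tail C' (p' ! 0) \<in> verts C'"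
    using p chain_arc[OF C(1) p(1), of 0] chain_arc[OF C(2) p(2), of 0] arc_in_component C by auto
  ultimately show ?thesis
    using components_eq_if_common_vert[OF C] tail_C[OF C(1)] tail_C[OF C(2)] by metis
qed

text \<open>Equal images read equal letters; over the length of \<open>w\<close> these fix the
  circle position, hence the first lifted arc.\<close>

lemma long_chains_same_component:
  assumes C: "C \<in> components P" "C' \<in> components P" and p: "chain C p" "chain C' p'"
    and len: "length w \<le> length p" "length w \<le> length p'"
    and eq: "\<And>k. k < length w \<Longrightarrow> fst (p ! k) = fst (p' ! k)"
  shows "C = C'"
proof (rule chains_same_component[OF C p])
  have 0: "0 < length p" "0 < length p'" using len w_pos by linarith+
  then show "p \<noteq> []" "p' \<noteq> []" by auto
  show "fst (p ! 0) = fst (p' ! 0)" using eq w_pos by blast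
  show "snd (p ! 0) = snd (p' ! 0)"
  proof (rule primitive_word_sync[OF prim])
    show "snd (p ! 0) < length w" "snd (p' ! 0) < length w"
      using arcs_component(2) C chain_arc p 0 by blast+
    fix k assume k: "k < length w"
    show "w ! ((snd (p ! 0) + k) mod length w) = w ! ((snd (p' ! 0) + k) mod length w)"
      using chain_letter[OF C(1) p(1), of k] chain_letter[OF C(2) p(2), of k] eq[OF k] k len by simp
  qed
qed

section \<open>Arcs that determine a component, and their existence\<close>

text \<open>Unites the whole and the initial case. Index 0 is exempt so that \<open>a\<close> may
  leave \<open>Vbar\<close>. A chain shorter than \<open>w\<close> must reach \<open>Vbar\<close>
  and use position \<open>m\<close>, which replaces synchronisation.\<close>

definition begins_at :: "nat \<Rightarrow> 'b \<Rightarrow> ('a \<times> nat, 'b \<times> nat) pre_digraph \<Rightarrow> bool" where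
  "begins_at m a C \<longleftrightarrow> (\<exists>p. p \<noteq> [] \<and> chain C p \<and> fst (p ! 0) = a \<and>
     (\<forall>k. 0 < k \<and> k < length p \<longrightarrow> tail G (fst (p ! k)) \<notin> Vbar G) \<and>
     (length w \<le> length p \<or> head G (fst (last p)) \<in> Vbar G \<and> m \<in> snd ` set p))"

text \<open>The terminal case; the last arc is exempt so that it may enter
  \<open>Vbar\<close>.\<close>

definition ends_at :: "'b \<Rightarrow> ('a \<times> nat, 'b \<times> nat) pre_digraph \<Rightarrow> bool" where
  "ends_at b C \<longleftrightarrow> (\<exists>p. chain C p \<and> fst (last p) = b \<and>
     (\<forall>k. Suc k < length p \<longrightarrow> head G (fst (p ! k)) \<notin> Vbar G) \<and> length w \<le> length p)"

text \<open>Each inner vertex of the image of \<open>p\<close> has a single outgoing arc, so the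
  images can never diverge.\<close>

lemma chains_agree:
  assumes C: "C \<in> components P" "C' \<in> components P" and p: "chain C p" "chain C' p'"
    and 0: "fst (p ! 0) = fst (p' ! 0)"
    and "\<And>k. 0 < k \<Longrightarrow> k < length p \<Longrightarrow> tail G (fst (p ! k)) \<notin> Vbar G"
    and "k < length p" "k < length p'"
  shows "fst (p ! k) = fst (p' ! k)"
  using assms(7,8)
proof (induction k)
  case (Suc k)
  show ?case
  proof (rule out_arc_unique)
    show "fst (p ! Suc k) \<in> arcs G" "fst (p' ! Suc k) \<in> arcs G"
      using Suc arcs_component(1) C chain_arc p by blast+
    show "tail G (fst (p ! Suc k)) = tail G (fst (p' ! Suc k))"
      using Suc chain_step(1)[OF C(1) p(1), of k] chain_step(1)[OF C(2) p(2), of k] by simp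
    show "tail G (fst (p ! Suc k)) \<notin> Vbar G" using Suc.prems assms(6) by blast
  qed
qed (use 0 in simp)

text \<open>A longer \<open>p'\<close> would follow the image of \<open>p\<close> to its end in
  \<open>Vbar\<close> and leave from there at an inner index.\<close>

lemma chain_length_le:
  assumes C: "C \<in> components P" "C' \<in> components P" and p: "chain C p" "chain C' p'" "p \<noteq> []"
    and 0: "fst (p ! 0) = fst (p' ! 0)"
    and inner: "\<And>k. 0 < k \<Longrightarrow> k < length p \<Longrightarrow> tail G (fst (p ! k)) \<notin> Vbar G"
      "\<And>k. 0 < k \<Longrightarrow> k < length p' \<Longrightarrow> tail G (fst (p' ! k)) \<notin> Vbar G"
    and last: "head G (fst (last p)) \<in> Vbar G"
  shows "length p' \<le> length p"
proof (rule ccontr)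
  assume longer: "\<not> length p' \<le> length p"
  define k where "k = length p - 1"
  have k: "k < length p" "Suc k < length p'" using p(3) longer by (auto simp: k_def)
  have "fst (last p) = fst (p' ! k)"
    using chains_agree[OF C p(1,2) 0 inner(1), of k] k p(3) by (simp add: last_conv_nth k_def)
  then have "tail G (fst (p' ! Suc k)) \<in> Vbar G"
    using chain_step(1)[OF C(2) p(2) k(2)] last by simp
  then show False using inner(2)[of "Suc k"] k by simp
qed

lemma begins_at_unique:
  assumes m: "\<And>i j l. i < length w \<Longrightarrow> j < length w \<Longrightarrow>
      \<forall>k<l. w ! ((i + k) mod length w) = w ! ((j + k) mod length w) \<Longrightarrow>
      \<exists>k<l. (i + k) mod length w = m \<Longrightarrow> \<exists>k<l. (j + k) mod length w = m \<Longrightarrow> i = j"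
    and C: "C \<in> components P" "C' \<in> components P" and "begins_at m a C" "begins_at m a C'"
  shows "C = C'"
proof -
  obtain p where p: "p \<noteq> []" "chain C p" "fst (p ! 0) = a"
    "\<And>k. 0 < k \<Longrightarrow> k < length p \<Longrightarrow> tail G (fst (p ! k)) \<notin> Vbar G"
    "length w \<le> length p \<or> head G (fst (last p)) \<in> Vbar G \<and> m \<in> snd ` set p"
    using assms(4) by (auto simp: begins_at_def)
  obtain p' where p': "p' \<noteq> []" "chain C' p'" "fst (p' ! 0) = a"
    "\<And>k. 0 < k \<Longrightarrow> k < length p' \<Longrightarrow> tail G (fst (p' ! k)) \<notin> Vbar G"
    "length w \<le> length p' \<or> head G (fst (last p')) \<in> Vbar G \<and> m \<in> snd ` set p'"
    using assms(5) by (auto simp: begins_at_def)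
  have a: "fst (p ! 0) = fst (p' ! 0)" using p p' by simp
  note agree = chains_agree[OF C p(2) p'(2) a p(4)]
  have le: "length p' \<le> length p" if "head G (fst (last p)) \<in> Vbar G"
    using chain_length_le[OF C p(2) p'(2) p(1) a p(4) p'(4)] that by blast
  have ge: "length p \<le> length p'" if "head G (fst (last p')) \<in> Vbar G"
    using chain_length_le[OF C(2,1) p'(2) p(2) p'(1) a[symmetric] p'(4) p(4)] that by blast
  show ?thesis
  proof (cases "length w \<le> length p \<and> length w \<le> length p'")
    case True
    then show ?thesis
      by (intro long_chains_same_component[OF C p(2) p'(2)] agree) auto
  next
    case False
    \<comment> \<open>One chain is shorter than \<open>w\<close>, so it ends in \<open>Vbar\<close>;
      the other cannot be longer and is therefore short as well.\<close>
    then have short: "head G (fst (last p)) \<in> Vbar G" "m \<in> snd ` set p"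
      "head G (fst (last p')) \<in> Vbar G" "m \<in> snd ` set p'"
      using p(5) p'(5) le ge by auto
    then have len: "length p' = length p" using le ge by simp
    show ?thesis
    proof (rule chains_same_component[OF C p(2) p'(2) p(1) p'(1) a], rule m)
      show "snd (p ! 0) < length w" "snd (p' ! 0) < length w"
        using arcs_component(2) C chain_arc p(1,2) p'(1,2) by blast+
      show "\<forall>k<length p. w ! ((snd (p ! 0) + k) mod length w) = w ! ((snd (p' ! 0) + k) mod length w)"
        using chain_letter[OF C(1) p(2)] chain_letter[OF C(2) p'(2)] agree len by metis
      obtain k where "k < length p" "m = snd (p ! k)"
        using short(2) in_set_conv_nth[of m "map snd p"] by auto
      then show "\<exists>k<length p. (snd (p ! 0) + k) mod length w = m"
        using chain_position[OF C(1) p(2), of k] by auto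
      obtain k' where "k' < length p'" "m = snd (p' ! k')"
        using short(4) in_set_conv_nth[of m "map snd p'"] by auto
      then show "\<exists>k<length p. (snd (p' ! 0) + k) mod length w = m"
        using chain_position[OF C(2) p'(2), of k'] len by auto
    qed
  qed
qed

text \<open>Runs backwards from the common last arc: inner heads have a single incoming arc, so the
  last stretches of the length of \<open>w\<close> have the same image.\<close>

lemma ends_at_unique:
  assumes C: "C \<in> components P" "C' \<in> components P" and "ends_at b C" "ends_at b C'"
  shows "C = C'"
proof -
  let ?n = "length w"
  have suffix: "\<exists>q. chain C q \<and> length q = ?n \<and> fst (q ! (?n - 1)) = b \<and>
      (\<forall>k. Suc k < ?n \<longrightarrow> head G (fst (q ! k)) \<notin> Vbar G)" if ends: "ends_at b C" for C
  proof -
    obtain p where p: "chain C p" "fst (last p) = b" "length w \<le> length p"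
      "\<And>k. Suc k < length p \<Longrightarrow> head G (fst (p ! k)) \<notin> Vbar G"
      using ends unfolding ends_at_def by blast
    \<comment> \<open>Trimming to exactly the length of \<open>w\<close> aligns the indices of the
      two chains at their ends.\<close>
    define q where "q = drop (length p - ?n) p"
    have q: "length q = ?n" using p(3) by (simp add: q_def)
    have "length p - ?n < length p" using w_pos p(3) by linarith
    then have "last q = last p" by (simp add: q_def)
    moreover have "q \<noteq> []" using q w_pos by auto
    ultimately have "fst (q ! (?n - 1)) = b" using p(2) q by (simp add: last_conv_nth)
    moreover have "head G (fst (q ! k)) \<notin> Vbar G" if "Suc k < ?n" for k
      using p(4)[of "length p - ?n + k"] that p(3) by (simp add: q_def)
    moreover have "chain C q" unfolding q_def using p(1) by (rule chain_drop)
    ultimately show ?thesis using q by blast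
  qed
  obtain q where q: "chain C q" "length q = ?n" "fst (q ! (?n - 1)) = b"
      "\<And>k. Suc k < ?n \<Longrightarrow> head G (fst (q ! k)) \<notin> Vbar G"
    using suffix[OF assms(3)] by blast
  obtain q' where q': "chain C' q'" "length q' = ?n" "fst (q' ! (?n - 1)) = b"
    using suffix[OF assms(4)] by blast
  have agree: "fst (q ! (?n - Suc k)) = fst (q' ! (?n - Suc k))" if "k < ?n" for k
    using that
  proof (induction k)
    case (Suc k)
    define j where "j = ?n - Suc (Suc k)"
    have j: "Suc j < ?n" "Suc j = ?n - Suc k" using Suc.prems by (auto simp: j_def)
    have "fst (q ! j) = fst (q' ! j)"
    proof (rule in_arc_unique)
      show "fst (q ! j) \<in> arcs G" "fst (q' ! j) \<in> arcs G"
        using arcs_component(1)[OF C(1) chain_arc[OF C(1) q(1)]]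
          arcs_component(1)[OF C(2) chain_arc[OF C(2) q'(1)]] j q q' by auto
      show "head G (fst (q ! j)) = head G (fst (q' ! j))"
        using chain_step(1)[OF C(1) q(1), of j] chain_step(1)[OF C(2) q'(1), of j] j q(2) q'(2) Suc
        by simp
      show "head G (fst (q ! j)) \<notin> Vbar G" using q(4) j by blast
    qed
    then show ?case by (simp add: j_def)
  qed (use q q' in simp)
  show ?thesis
  proof (rule long_chains_same_component[OF C q(1) q'(1)])
    fix k assume "k < ?n"
    then show "fst (q ! k) = fst (q' ! k)" using agree[of "?n - Suc k"] by simp
  qed (use q q' in auto)
qed

text \<open>If no chain as required existed, the vertices on chains avoiding \<open>Vbar\<close> of length at least that
  of \<open>w\<close> would be closed under adjacency, hence exhaust the component.\<close>

lemma extend_unbranched_chain: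
  assumes C: "C \<in> components P" and z: "z \<in> verts C" "fst z \<in> Vbar G"
    and p: "chain C p" "length w \<le> length p"
      "\<forall>a\<in>set p. tail G (fst a) \<notin> Vbar G \<and> head G (fst a) \<notin> Vbar G"
  shows "(\<exists>a\<in>arcs G. tail G a \<in> Vbar G \<and> begins_at m a C) \<or>
    (\<exists>b\<in>arcs G. head G b \<in> Vbar G \<and> ends_at b C)"
proof (rule ccontr)
  assume none: "\<not> ?thesis"
  define Q where "Q q \<longleftrightarrow> chain C q \<and> length w \<le> length q \<and>
    (\<forall>a\<in>set q. tail G (fst a) \<notin> Vbar G \<and> head G (fst a) \<notin> Vbar G)" for q
  define X where "X = {v. \<exists>q a. Q q \<and> a \<in> set q \<and> (v = tail C a \<or> v = head C a)}"
  have Q_ne: "q \<noteq> []" if "Q q" for q using that w_pos by (auto simp: Q_def)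
  have X_arc: "tail C a \<in> X" "head C a \<in> X" if "Q q" "a \<in> set q" for q a
    using that unfolding X_def by blast+
  have closed_backwards: "tail C c \<in> X" if c: "c \<in> arcs C" "head C c \<in> X" for c
  proof -
    obtain q a where q: "Q q" "a \<in> set q" "head C c = tail C a \<or> head C c = head C a"
      using c(2) unfolding X_def by blast
    have aC: "a \<in> arcs C" using q by (auto simp: Q_def chain_def)
    \<comment> \<open>A vertex of \<open>X\<close> is the head of an arc of \<open>q\<close>, the
      tail of its first arc, or the tail of a later arc and then also the head of the preceding
      one.\<close>
    consider "head C c = head C a" | "a = q ! 0" "head C c = tail C a" |
      j where "Suc j < length q" "a = q ! Suc j" "head C c = tail C a"
      using q(2,3) unfolding in_set_conv_nth by (metis not0_implies_Suc)
    then show ?thesis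
    proof cases
      case 2
      have chain: "chain C (c # q)"
        using 2 c(1) q(1) Q_ne[OF q(1)] by (intro chain_Cons) (auto simp: Q_def hd_conv_nth)
      show ?thesis
      proof (cases "tail G (fst c) \<in> Vbar G")
        case True
        \<comment> \<open>Prepending \<open>c\<close> keeps the chain at least as long as
          \<open>w\<close>, so the first alternative in the definition applies.\<close>
        have "begins_at m (fst c) C"
          unfolding begins_at_def
          using chain q(1) by (intro exI[of _ "c # q"]) (auto simp: Q_def nth_Cons')
        then show ?thesis using none True arcs_component(1)[OF C c(1)] by blast
      next
        case False
        have "head G (fst c) \<notin> Vbar G"
          using 2(2) q(1,2) tail_C[OF C] head_C[OF C] by (auto simp: Q_def)
        then have "Q (c # q)" using chain q(1) False by (auto simp: Q_def)
        then show ?thesis by (rule X_arc) simp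
      qed
    next
      case 1
      \<comment> \<open>Heads off \<open>Vbar\<close> have one incoming arc in the graph, and every
        vertex of the circle has one incoming arc, so both coordinates agree.\<close>
      have "fst c = fst a"
        using 1 q(1,2) head_C[OF C] arcs_component(1)[OF C c(1)] arcs_component(1)[OF C aC]
        by (intro in_arc_unique) (auto simp: Q_def)
      moreover have "snd c = snd a"
        using 1 head_C[OF C] arcs_component(2)[OF C c(1)] arcs_component(2)[OF C aC]
        by (auto simp: mod_Suc split: if_splits)
      ultimately have "c = a" by (simp add: prod_eq_iff)
      then show ?thesis using X_arc q by blast
    next
      case (3 j)
      define b where "b = q ! j"
      have b: "b \<in> set q" "head C b = tail C a"
        using 3 q(1) by (auto simp: b_def Q_def chain_def)
      then have bC: "b \<in> arcs C" using q(1) by (auto simp: Q_def chain_def)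
      have hd: "head C c = head C b" using 3 b by simp
      have "fst c = fst b"
        using hd q(1) b(1) head_C[OF C] arcs_component(1)[OF C c(1)] arcs_component(1)[OF C bC]
        by (intro in_arc_unique) (auto simp: Q_def)
      moreover have "snd c = snd b"
        using hd head_C[OF C] arcs_component(2)[OF C c(1)] arcs_component(2)[OF C bC]
        by (auto simp: mod_Suc split: if_splits)
      ultimately have "c = b" by (simp add: prod_eq_iff)
      then show ?thesis using X_arc q(1) b(1) by blast
    qed
  qed
  have closed_forwards: "head C c \<in> X" if c: "c \<in> arcs C" "tail C c \<in> X" for c
  proof -
    obtain q a where q: "Q q" "a \<in> set q" "tail C c = tail C a \<or> tail C c = head C a"
      using c(2) unfolding X_def by blast
    \<comment> \<open>The only arc of the component leaving the tail of \<open>b\<close> is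
      \<open>b\<close> itself.\<close>
    have same: "head C c \<in> X" if "b \<in> set q" "tail C c = tail C b" for b
    proof -
      have bC: "b \<in> arcs C" using q(1) that by (auto simp: Q_def chain_def)
      have "fst c = fst b"
        using that q(1) tail_C[OF C] arcs_component(1)[OF C c(1)] arcs_component(1)[OF C bC]
        by (intro out_arc_unique) (auto simp: Q_def)
      moreover have "snd c = snd b" using that tail_C[OF C] by auto
      ultimately have "c = b" by (simp add: prod_eq_iff)
      then show ?thesis using X_arc q(1) that by blast
    qed
    consider "tail C c = tail C a" | "a = last q" "tail C c = head C a" |
      j where "Suc j < length q" "a = q ! j" "tail C c = head C a"
      using q(2,3) unfolding in_set_conv_nth
      by (metis Q_ne[OF q(1)] Suc_lessI diff_Suc_1 last_conv_nth)
    then show ?thesis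
    proof cases
      case 1
      then show ?thesis using same q(2) by blast
    next
      case (3 j)
      then have "tail C c = tail C (q ! Suc j)" using q(1) by (auto simp: Q_def chain_def)
      then show ?thesis using same[OF nth_mem] 3(1) by blast
    next
      case 2
      have chain: "chain C (q @ [c])"
        using 2 c(1) q(1) Q_ne[OF q(1)] by (intro chain_snoc) (auto simp: Q_def)
      show ?thesis
      proof (cases "head G (fst c) \<in> Vbar G")
        case True
        have "ends_at (fst c) C"
          unfolding ends_at_def
          using chain q(1) by (intro exI[of _ "q @ [c]"]) (auto simp: Q_def nth_append)
        then show ?thesis using none True arcs_component(1)[OF C c(1)] by blast
      next
        case False
        have "tail G (fst c) \<notin> Vbar G"
          using 2(2) q(1,2) tail_C[OF C] head_C[OF C] by (auto simp: Q_def)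
        then have "Q (q @ [c])" using chain q(1) False by (auto simp: Q_def)
        then show ?thesis by (rule X_arc) simp
      qed
    qed
  qed
  have "Q p" using p by (simp add: Q_def)
  then have "X \<noteq> {}" using Q_ne[of p] X_arc(1)[of p "hd p"] by auto
  moreover have "X \<subseteq> verts C"
    using arc_in_component[OF C] by (auto simp: X_def Q_def chain_def)
  moreover have "\<forall>a\<in>arcs C. tail C a \<in> X \<longleftrightarrow> head C a \<in> X" using closed_backwards closed_forwards by blast
  ultimately have "X = verts C"
    using component_connected[OF C] connected_iff_closed[OF component_wf[OF C]] by blast
  \<comment> \<open>All vertices of \<open>X\<close> lie over the complement of \<open>Vbar\<close>,
    whereas \<open>z\<close> does not.\<close>
  then have "z \<in> X" using z by simp
  then show False
    using z(2) tail_C[OF C] head_C[OF C] by (auto simp: X_def Q_def)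
qed

lemma begins_or_ends:
  assumes C: "C \<in> components P" and z: "z \<in> verts C" "fst z \<in> Vbar G"
    and p: "chain C p" "3 * length w \<le> length p" and m: "m < length w"
  shows "(\<exists>a\<in>arcs G. tail G a \<in> Vbar G \<and> begins_at m a C) \<or>
    (\<exists>b\<in>arcs G. head G b \<in> Vbar G \<and> ends_at b C)"
proof -
  let ?n = "length w"
  define i where "i = snd (p ! 0)"
  \<comment> \<open>The first index from the length of \<open>w\<close> on whose arc has position
    \<open>m\<close>. It is below twice that length, so at least the length of \<open>w\<close>
    remains on each side of arc \<open>v\<close>.\<close>
  define v where "v = ?n + (m + ?n - i) mod ?n"
  have "0 < length p" using p(2) w_pos by linarith
  then have i: "i < ?n" using arcs_component(2)[OF C chain_arc[OF C p(1)]] by (simp add: i_def)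
  have v: "?n \<le> v" "v < 2 * ?n" using w_pos by (auto simp: v_def)
  have v_len: "v < length p" using v p(2) by linarith
  have pv: "snd (p ! v) = m"
  proof -
    have "snd (p ! v) = (i + v) mod ?n" using chain_position[OF C p(1) v_len] by (simp add: i_def)
    also have "\<dots> = (i + (m + ?n - i)) mod ?n" by (simp add: v_def mod_simps add.left_commute[of i])
    also have "\<dots> = m" using i m by simp
    finally show ?thesis .
  qed
  have step: "tail G (fst (p ! Suc k)) = head G (fst (p ! k))" if "Suc k < length p" for k
    using chain_step(1)[OF C p(1) that] .
  show ?thesis
  proof (cases "\<exists>t\<le>v. tail G (fst (p ! t)) \<in> Vbar G")
    case False
    have "tail G (fst a) \<notin> Vbar G \<and> head G (fst a) \<notin> Vbar G" if a: "a \<in> set (take v p)" for a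
    proof -
      obtain k where k: "k < v" "a = p ! k" using a by (auto simp: in_set_conv_nth)
      \<comment> \<open>The search includes index \<open>v\<close>, whose tail is the head of the
        arc before it.\<close>
      have "tail G (fst (p ! k)) \<notin> Vbar G" "tail G (fst (p ! Suc k)) \<notin> Vbar G"
        using False k by auto
      then show ?thesis using step[of k] k v_len by simp
    qed
    then show ?thesis
      using v v_len by (intro extend_unbranched_chain[OF C z chain_take[OF p(1), of v]]) auto
  next
    case True
    show ?thesis
    proof (cases "\<exists>t\<ge>v. t < length p \<and> head G (fst (p ! t)) \<in> Vbar G")
      case False
      \<comment> \<open>Arc \<open>v\<close> itself is dropped, since only its head is known to
        avoid \<open>Vbar\<close>; the remainder is still at least as long as
        \<open>w\<close>.\<close>
      have "tail G (fst a) \<notin> Vbar G \<and> head G (fst a) \<notin> Vbar G" if a: "a \<in> set (drop (Suc v) p)" for a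
      proof -
        obtain k where k: "k < length p - Suc v" "a = p ! (Suc v + k)"
          using a by (auto simp: in_set_conv_nth)
        have "head G (fst (p ! (v + k))) \<notin> Vbar G" "head G (fst (p ! (Suc v + k))) \<notin> Vbar G"
          using False k by auto
        then show ?thesis using step[of "v + k"] k by simp
      qed
      then show ?thesis
        using v v_len p(2) by (intro extend_unbranched_chain[OF C z chain_drop[OF p(1), of "Suc v"]]) auto
    next
      case ex: True
      \<comment> \<open>The last departure from \<open>Vbar\<close> up to \<open>v\<close> and the
        first arrival from \<open>v\<close> on: the arcs from \<open>s\<close> to \<open>t\<close>
        lift a whole segment through position \<open>m\<close>.\<close>
      define s where "s = (GREATEST t. t \<le> v \<and> tail G (fst (p ! t)) \<in> Vbar G)"
      define t where "t = (LEAST t. t \<ge> v \<and> t < length p \<and> head G (fst (p ! t)) \<in> Vbar G)"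
      have s: "s \<le> v" "tail G (fst (p ! s)) \<in> Vbar G"
        using GreatestI_ex_nat[of "\<lambda>t. t \<le> v \<and> tail G (fst (p ! t)) \<in> Vbar G" v] True
        by (auto simp: s_def)
      have s_max: "tail G (fst (p ! k)) \<notin> Vbar G" if "s < k" "k \<le> v" for k
        using Greatest_le_nat[of "\<lambda>t. t \<le> v \<and> tail G (fst (p ! t)) \<in> Vbar G" k v] that
        by (auto simp: s_def)
      have t: "v \<le> t" "t < length p" "head G (fst (p ! t)) \<in> Vbar G"
        using LeastI_ex[of "\<lambda>t. t \<ge> v \<and> t < length p \<and> head G (fst (p ! t)) \<in> Vbar G"] ex
        by (auto simp: t_def)
      have t_min: "head G (fst (p ! k)) \<notin> Vbar G" if "v \<le> k" "k < t" for k
        using not_less_Least[of k "\<lambda>t. t \<ge> v \<and> t < length p \<and> head G (fst (p ! t)) \<in> Vbar G"] that t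
        by (auto simp: t_def)
      define q where "q = take (Suc t - s) (drop s p)"
      have len: "length q = Suc t - s" using s t by (simp add: q_def)
      have q: "q ! k = p ! (s + k)" if "k < length q" for k
        using that s t by (simp add: q_def)
      have "begins_at m (fst (p ! s)) C"
        unfolding begins_at_def
      proof (intro exI[of _ q] conjI allI impI disjI2)
        show "q \<noteq> []" using len s t by auto
        then show "fst (q ! 0) = fst (p ! s)" using q[of 0] by simp
        show "chain C q" unfolding q_def by (intro chain_take chain_drop p)
        \<comment> \<open>Up to \<open>v\<close> this is maximality of \<open>s\<close>; beyond
          \<open>v\<close> the tail is the head of the preceding arc, excluded by minimality of
          \<open>t\<close>.\<close>
        show "tail G (fst (q ! k)) \<notin> Vbar G" if k: "0 < k \<and> k < length q" for k
        proof (cases "s + k \<le> v")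
          case True
          then show ?thesis using s_max[of "s + k"] that q by simp
        next
          case False
          then obtain j where j: "s + k = Suc j" "v \<le> j" "j < t"
            using k len by (cases "s + k") auto
          then show ?thesis using t_min[of j] step[of j] t that q by simp
        qed
        show "head G (fst (last q)) \<in> Vbar G"
          using t s len q[of "t - s"] \<open>q \<noteq> []\<close> by (simp add: last_conv_nth Suc_diff_le)
        have "q ! (v - s) = p ! v" "v - s < length q" using q[of "v - s"] s t len by auto
        then show "m \<in> snd ` set q" using pv by (metis image_eqI nth_mem)
      qed
      moreover have "fst (p ! s) \<in> arcs G"
        using arcs_component(1)[OF C chain_arc[OF C p(1)]] s v_len by simp
      ultimately show ?thesis using s by blast
    qed
  qed
qed

section \<open>Counting the components\<close>

text \<open>The factor 2 comes from charging each component to an arc leaving \<open>Vbar\<close> or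
  to an arc entering it; the two sets of arcs are equally large, and each is at most
  \<open>card (Ebar G)\<close>.\<close>

lemma card_components_le:
  assumes "S \<subseteq> components P"
    and "\<And>C. C \<in> S \<Longrightarrow> \<exists>z\<in>verts C. fst z \<in> Vbar G"
    and "\<And>C. C \<in> S \<Longrightarrow> \<exists>p. chain C p \<and> 3 * length w \<le> length p"
  shows "finite S \<and> card S \<le> 2 * card (Ebar G)"
proof -
  obtain m where m: "m < length w"
    "\<And>i j l. i < length w \<Longrightarrow> j < length w \<Longrightarrow>
      \<forall>k<l. w ! ((i + k) mod length w) = w ! ((j + k) mod length w) \<Longrightarrow>
      \<exists>k<l. (i + k) mod length w = m \<Longrightarrow> \<exists>k<l. (j + k) mod length w = m \<Longrightarrow> i = j"
    using ex_separating_position[OF prim] by blast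
  define A where "A = {a \<in> arcs G. tail G a \<in> Vbar G}"
  define B where "B = {b \<in> arcs G. head G b \<in> Vbar G}"
  have fin: "finite A" "finite B" by (auto simp: A_def B_def)
  \<comment> \<open>Choosing one related arc per component is injective, as an arc is related to at
    most one component.\<close>
  have bound: "finite T \<and> card T \<le> card F"
    if F: "finite F" and ex: "\<And>C. C \<in> T \<Longrightarrow> \<exists>a\<in>F. R a C" and
      unique: "\<And>a C C'. C \<in> T \<Longrightarrow> C' \<in> T \<Longrightarrow> R a C \<Longrightarrow> R a C' \<Longrightarrow> C = C'"
    for F :: "'b set" and T :: "('a \<times> nat, 'b \<times> nat) pre_digraph set" and R
  proof -
    obtain f where f: "\<And>C. C \<in> T \<Longrightarrow> f C \<in> F \<and> R (f C) C" using ex by metis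
    then have "inj_on f T" using unique by (intro inj_onI) metis
    moreover have "f ` T \<subseteq> F" using f by auto
    ultimately show ?thesis
      using F card_inj_on_le[of f T F] inj_on_finite[of f T F] by blast
  qed
  define S1 where "S1 = {C \<in> S. \<exists>a\<in>A. begins_at m a C}"
  define S2 where "S2 = {C \<in> S. \<exists>b\<in>B. ends_at b C}"
  have S1: "finite S1 \<and> card S1 \<le> card A"
  proof (rule bound[OF fin(1)])
    show "\<exists>a\<in>A. begins_at m a C" if "C \<in> S1" for C using that by (simp add: S1_def)
    fix a C C' assume *: "C \<in> S1" "C' \<in> S1" "begins_at m a C" "begins_at m a C'"
    then have P: "C \<in> components P" "C' \<in> components P"
      using assms(1) by (auto simp: S1_def)
    show "C = C'" by (rule begins_at_unique[OF _ P *(3,4)]) (fact m(2))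
  qed
  have S2: "finite S2 \<and> card S2 \<le> card B"
  proof (rule bound[OF fin(2)])
    show "\<exists>b\<in>B. ends_at b C" if "C \<in> S2" for C using that by (simp add: S2_def)
    fix b C C' assume "C \<in> S2" "C' \<in> S2" "ends_at b C" "ends_at b C'"
    moreover from this have "C \<in> components P" "C' \<in> components P"
      using assms(1) by (auto simp: S2_def)
    ultimately show "C = C'" using ends_at_unique by blast
  qed
  have S: "S = S1 \<union> S2"
  proof -
    have "C \<in> S1 \<union> S2" if C: "C \<in> S" for C
    proof -
      obtain z p where "z \<in> verts C" "fst z \<in> Vbar G" "chain C p" "3 * length w \<le> length p"
        using assms(2,3)[OF C] by blast
      moreover have "C \<in> components P" using assms(1) that by blast
      ultimately show ?thesis
        using begins_or_ends m(1) that unfolding S1_def S2_def A_def B_def by blast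
    qed
    then show ?thesis by (auto simp: S1_def S2_def)
  qed
  have "card S \<le> card S1 + card S2" unfolding S by (rule card_Un_le)
  also have "\<dots> \<le> card A + card B" using S1 S2 by simp
  also have "\<dots> = 2 * card A"
    using card_arcs_from_Vbar_eq_card_arcs_to_Vbar by (simp add: A_def B_def)
  also have "\<dots> \<le> 2 * card (Ebar G)" using card_arcs_from_Vbar_le by (simp add: A_def)
  finally show ?thesis using S S1 S2 by simp
qed

end

theorem theorem4p21:
  fixes \<Gamma> :: "('a, 'b) pre_digraph" and \<Delta> :: "('c, 'd) pre_digraph"
    and \<gamma> :: "('a, 'b, 'c, 'd) graph_map" and w :: "'d list"
  assumes "fin_digraph \<Gamma>" and "fin_digraph \<Delta>"
    and "forwards_immersion \<Gamma> \<Delta> \<gamma>"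
    and "is_loop \<Delta> w" and "primitive_path \<Delta> w"
  shows "finite {C \<in> components (Omega_ge 3 \<Gamma> \<Delta> \<gamma> w). \<not> maps_into proj1 C (minus_Vbar \<Gamma>)} \<and>
    card {C \<in> components (Omega_ge 3 \<Gamma> \<Delta> \<gamma> w). \<not> maps_into proj1 C (minus_Vbar \<Gamma>)}
      \<le> 2 * card (Ebar \<Gamma>)"
proof -
  interpret \<Gamma>: fin_digraph \<Gamma> by fact
  interpret \<Delta>: fin_digraph \<Delta> by fact
  have "primitive_word w"
    using primitive_word_if_primitive_path[OF \<Delta>.wf_digraph_axioms assms(4,5)] .
  then interpret loop_fibre_product \<Gamma> \<Delta> \<gamma> w by unfold_locales
  have Omega: "components (Omega \<Gamma> \<Delta> \<gamma> w) \<subseteq> components P"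
    unfolding Omega_def Let_def by (rule subset_trans[OF components_Union_subset]) blast+
  have Omega_ge: "components (Omega_ge 3 \<Gamma> \<Delta> \<gamma> w) \<subseteq>
      {C \<in> components (Omega \<Gamma> \<Delta> \<gamma> w). \<exists>x p y. pre_digraph.awalk C x p y \<and>
        w_path \<Gamma> \<Delta> \<gamma> w (map fst p) \<and> 3 \<le> w_length \<gamma> w (map fst p)}"
    unfolding Omega_ge_def by (rule components_Union_subset) blast
  show ?thesis
  proof (rule card_components_le)
    show "{C \<in> components (Omega_ge 3 \<Gamma> \<Delta> \<gamma> w). \<not> maps_into proj1 C (minus_Vbar \<Gamma>)} \<subseteq> components P"
      using Omega Omega_ge by blast
    fix C assume "C \<in> {C \<in> components (Omega_ge 3 \<Gamma> \<Delta> \<gamma> w). \<not> maps_into proj1 C (minus_Vbar \<Gamma>)}"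
    then have C: "C \<in> components P" and branched: "\<not> maps_into proj1 C (minus_Vbar \<Gamma>)"
      and long: "\<exists>x p y. pre_digraph.awalk C x p y \<and>
        w_path \<Gamma> \<Delta> \<gamma> w (map fst p) \<and> 3 \<le> w_length \<gamma> w (map fst p)"
      using Omega Omega_ge by blast+
    show "\<exists>z\<in>verts C. fst z \<in> Vbar \<Gamma>"
    proof (rule ccontr)
      assume no: "\<not> ?thesis"
      \<comment> \<open>If no vertex lies over \<open>Vbar\<close>, both ends of every image arc
        avoid it, so the component maps into the induced subgraph.\<close>
      have V: "fst z \<in> verts \<Gamma> - Vbar \<Gamma>" if "z \<in> verts C" for z
        using that no component_subgraph[OF C] by (auto simp: subgraph_def fibre_product_def)
      have "fst a \<in> arcs (minus_Vbar \<Gamma>)" if "a \<in> arcs C" for a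
        using arc_in_component[OF C that] arcs_component(1)[OF C that] V tail_C[OF C] head_C[OF C]
        by (fastforce simp: minus_Vbar_def induce_subgraph_def)
      then show False
        using branched V by (auto simp: maps_into_def proj1_def minus_Vbar_def)
    qed
    obtain x p y where p: "pre_digraph.awalk C x p y" "w_path \<Gamma> \<Delta> \<gamma> w (map fst p)"
      "3 \<le> w_length \<gamma> w (map fst p)"
      using long by blast
    have chain: "chain C p" using p(1) by (rule chain_if_awalk)
    have "3 * length w \<le> w_length \<gamma> w (map fst p) * length w" using p(3) by simp
    also have "\<dots> \<le> length p"
      using w_length_chain[OF C chain] w_path_length[OF p(2)] by simp
    finally show "\<exists>p. chain C p \<and> 3 * length w \<le> length p" using chain by blast
  qed
qed

end
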